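(* Let $n\ge 2$ be an integer, let $a\in(0,1)$, and let $d>0$ be small enough (i.e., $0<d<d_0$ for some $d_0>0$). Consider a distinct pair of words $\mathrm{w}_A,\mathrm{w}_B\in\{\mathfrak{0},\mathfrak{a},\mathfrak{1}\}^n$ with $(\mathrm{w}_A)_i\le(\mathrm{w}_B)_i$ for all $i\in\{1,\ldots,n\}$. Suppose furthermore that at least one of these two words is contained in $\{\mathfrak{0},\mathfrak{1}\}^n$. Then the $n$-periodic stationary solutions $u_{\mathrm{w}_A},u_{\mathrm{w}_B}$ of types $\mathrm{w}_A$ and $\mathrm{w}_B$ of the lattice Nagumo equation $$\dot u_i(t)=d\big(u_{i-1}(t)-2u_i(t)+u_{i+1}(t)\big)+g(u_i(t);a),\qquad i\in\mathbb{Z},\ t\in\mathbb{R},$$ with $g(u;a)=u(1-u)(u-a)$, satisfy the strict component-wise inequality $(u_{\mathrm{w}_A})_i<(u_{\mathrm{w}_B})_i$ for all $i\in\mathbb{Z}$.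
   Context: The letters are ordered by $\mathfrak{0}<\mathfrak{a}<\mathfrak{1}$. Types: define $G(\cdot\,;a,d):\mathbb{R}^n\to\mathbb{R}^n$ by $G_i(\mathrm{u};a,d)=d(\mathrm{u}_{i-1}-2\mathrm{u}_i+\mathrm{u}_{i+1})+g(\mathrm{u}_i;a)$, $i=1,\ldots,n$, indices modulo $n$. At $d=0$ every vector in $\{0,a,1\}^n$ is a zero of $G(\cdot\,;a,0)$ with invertible Jacobian, so by the implicit function theorem a unique branch of zeros of $G(\cdot\,;a,d)$, continuous in $d$ for small $d\geq 0$, emanates from it. For a word $\mathrm{w}\in\{\mathfrak{0},\mathfrak{a},\mathfrak{1}\}^n$ let $\mathrm{w}_a\in\{0,a,1\}^n$ be obtained by replacing the letters $\mathfrak{0},\mathfrak{a},\mathfrak{1}$ by the numbers $0,a,1$, respectively. The solution $\mathrm{u}_{\mathrm{w}}\in[0,1]^n$ of type $\mathrm{w}$ is the zero of $G(\cdot\,;a,d)$ lying on the branch emanating from $\mathrm{w}_a$ at $d=0$. The corresponding $n$-periodic stationary solution $u_{\mathrm{w}}$ of type $\mathrm{w}$ of the lattice equation is the periodic extension $(u_{\mathrm{w}})_i=(\mathrm{u}_{\mathrm{w}})_{\mathrm{mod}(i,n)}$, $i\in\mathbb{Z}$, with $\mathrm{mod}(i,n)\in\{1,\ldots,n\}$. *)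

theory Defs
  imports "HOL-Analysis.Analysis" "HOL-Library.FuncSet"
begin

datatype letter = L0 | La | L1

fun letter_rank :: "letter \<Rightarrow> nat" where
  "letter_rank L0 = 0"
| "letter_rank La = 1"
| "letter_rank L1 = 2"

instantiation letter :: linorder
begin

definition less_eq_letter :: "letter \<Rightarrow> letter \<Rightarrow> bool" where
  "x \<le> y \<longleftrightarrow> letter_rank x \<le> letter_rank y"

definition less_letter :: "letter \<Rightarrow> letter \<Rightarrow> bool" where
  "x < y \<longleftrightarrow> letter_rank x < letter_rank y"

instance
proof
  fix x y :: letter
  show "x = y" if "x \<le> y" "y \<le> x"
    using that by (cases x; cases y) (auto simp: less_eq_letter_def)
qed (auto simp: less_eq_letter_def less_letter_def)

end

lemma letter_order: "L0 < La" "La < L1"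
  by (simp_all add: less_letter_def)

(* Vectors and words of length n are functions on the indices 1, ..., n; they are
   extensional (undefined elsewhere), so equality of functions is equality of n-tuples. *)

definition vectors :: "nat \<Rightarrow> (int \<Rightarrow> real) set" where
  "vectors n = {1..int n} \<rightarrow>\<^sub>E UNIV"

definition words :: "nat \<Rightarrow> (int \<Rightarrow> letter) set" where
  "words n = {1..int n} \<rightarrow>\<^sub>E UNIV"

definition binary_words :: "nat \<Rightarrow> (int \<Rightarrow> letter) set" where
  "binary_words n = {1..int n} \<rightarrow>\<^sub>E {L0, L1}"

fun letter_val :: "real \<Rightarrow> letter \<Rightarrow> real" where
  "letter_val a L0 = 0"
| "letter_val a La = a"
| "letter_val a L1 = 1"

definition word_vec :: "nat \<Rightarrow> real \<Rightarrow> (int \<Rightarrow> letter) \<Rightarrow> (int \<Rightarrow> real)" where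
  "word_vec n a w = (\<lambda>i\<in>{1..int n}. letter_val a (w i))"

(* The representative of i modulo n in {1, ..., n} (instead of {0, ..., n - 1}). *)
definition wrap :: "nat \<Rightarrow> int \<Rightarrow> int" where
  "wrap n i = (i - 1) mod int n + 1"

definition g :: "real \<Rightarrow> real \<Rightarrow> real" where
  "g u a = u * (1 - u) * (u - a)"

definition G :: "nat \<Rightarrow> (int \<Rightarrow> real) \<Rightarrow> real \<Rightarrow> real \<Rightarrow> (int \<Rightarrow> real)" where
  "G n u a d = (\<lambda>i\<in>{1..int n}.
     d * (u (wrap n (i - 1)) - 2 * u i + u (wrap n (i + 1))) + g (u i) a)"

definition zero_of_G :: "nat \<Rightarrow> real \<Rightarrow> real \<Rightarrow> (int \<Rightarrow> real) \<Rightarrow> bool" where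
  "zero_of_G n a d u \<longleftrightarrow> u \<in> vectors n \<and> (\<forall>i\<in>{1..int n}. G n u a d i = 0)"

(* A branch of zeros over the parameter interval [0, d], emanating from the vector w_a. *)
definition branch ::
  "nat \<Rightarrow> real \<Rightarrow> (int \<Rightarrow> letter) \<Rightarrow> real \<Rightarrow> (real \<Rightarrow> int \<Rightarrow> real) \<Rightarrow> bool" where
  "branch n a w d v \<longleftrightarrow>
     v 0 = word_vec n a w \<and>
     (\<forall>t\<in>{0..d}. zero_of_G n a t (v t)) \<and>
     (\<forall>i\<in>{1..int n}. continuous_on {0..d} (\<lambda>t. v t i))"

(* The description is proper only for small d, where the branch exists and is unique by
   the implicit function theorem; any statement about the solution of type w has to
   establish this. *)
definition type_solution :: "nat \<Rightarrow> real \<Rightarrow> real \<Rightarrow> (int \<Rightarrow> letter) \<Rightarrow> (int \<Rightarrow> real)" where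
  "type_solution n a d w =
     (THE u. u \<in> {1..int n} \<rightarrow>\<^sub>E {0..1} \<and> (\<exists>v. branch n a w d v \<and> v d = u))"

definition periodic_extension :: "nat \<Rightarrow> (int \<Rightarrow> real) \<Rightarrow> (int \<Rightarrow> real)" where
  "periodic_extension n u = (\<lambda>i. u (wrap n i))"

definition periodic_type_solution ::
  "nat \<Rightarrow> real \<Rightarrow> real \<Rightarrow> (int \<Rightarrow> letter) \<Rightarrow> (int \<Rightarrow> real)" where
  "periodic_type_solution n a d w = periodic_extension n (type_solution n a d w)"

definition nagumo_lattice_solution :: "real \<Rightarrow> real \<Rightarrow> (real \<Rightarrow> int \<Rightarrow> real) \<Rightarrow> bool" where
  "nagumo_lattice_solution a d u \<longleftrightarrow>
     (\<forall>i t. ((\<lambda>s. u s i) has_real_derivative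
        d * (u t (i - 1) - 2 * u t i + u t (i + 1)) + g (u t i) a) (at t))"

lemma wrap_in: "n > 0 \<Longrightarrow> wrap n i \<in> {1..int n}"
  using pos_mod_bound[of "int n" "i - 1"] pos_mod_sign[of "int n" "i - 1"]
  unfolding wrap_def atLeastAtMost_iff by linarith

lemma wrap_add: "wrap n (wrap n i + k) = wrap n (i + k)"
proof -
  have "((i - 1) mod int n + k) mod int n = (i - 1 + k) mod int n"
    by (rule mod_add_left_eq)
  thus ?thesis by (simp add: wrap_def algebra_simps)
qed

(* The link between the n-dimensional problem defining type_solution and the lattice
   equation on all of int. *)
lemma periodic_extension_stationary:
  assumes "n > 0" "u \<in> vectors n"
  shows "zero_of_G n a d u \<longleftrightarrow> nagumo_lattice_solution a d (\<lambda>t. periodic_extension n u)"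
proof -
  define F where "F = (\<lambda>i. d * (u (wrap n (i - 1)) - 2 * u (wrap n i) + u (wrap n (i + 1)))
    + g (u (wrap n i)) a)"
  have w: "wrap n i = i" if "i \<in> {1..int n}" for i
    using that by (simp add: wrap_def)
  have GF: "G n u a d i = F i" if "i \<in> {1..int n}" for i
    using that by (simp add: G_def F_def w)
  have Fw: "F (wrap n i) = F i" for i
    using wrap_add[of n i "- 1"] wrap_add[of n i 1] wrap_add[of n i 0] by (simp add: F_def)
  have "zero_of_G n a d u \<longleftrightarrow> (\<forall>i. F i = 0)"
    using assms wrap_in[OF assms(1)] Fw GF unfolding zero_of_G_def by metis
  also have "\<dots> \<longleftrightarrow> nagumo_lattice_solution a d (\<lambda>t. periodic_extension n u)"
    unfolding nagumo_lattice_solution_def periodic_extension_def F_def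
    by (metis DERIV_const DERIV_unique)
  finally show ?thesis .
qed

end

theory Submission
  imports Defs
begin

text \<open>
  The function \<open>g\<close> is strictly monotone on a small interval around each of its zeros \<open>0\<close>, \<open>a\<close>, \<open>1\<close>:
  decreasing at the stable zeros \<open>0\<close> and \<open>1\<close>, increasing at \<open>a\<close>. On such an interval it expands
  distances by at least a fixed factor, while the discrete Laplacian changes by at most four times the
  supremum distance of its arguments. For small \<open>d\<close> the expansion wins, so among the lattice
  configurations close to a given word there is exactly one stationary solution
  (\<open>zero_exists\<close>, \<open>zero_unique\<close>), and it depends Lipschitz continuously on \<open>d\<close>
  (\<open>zero_lipschitz\<close>). A stationary solution that is close to its word is in fact strictly closer than
  the allowed radius (\<open>zero_strictly_near\<close>), so a continuous branch cannot leave the neighbourhood of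
  its word. Hence the solution of type \<open>w\<close> is the unique stationary solution close to \<open>w\<close>
  (\<open>periodic_type_solution_characterization\<close>); it takes its values in \<open>[0, 1]\<close> by the maximum
  principle, because \<open>g\<close> is positive to the left of \<open>0\<close> and negative to the right of \<open>1\<close>.

  The comparison (\<open>zero_comparison\<close>) is a strong maximum principle for the difference \<open>e = v - u\<close>
  of the two solutions. Where the words differ, \<open>e\<close> is positive, since the neighbourhoods of
  different letters are disjoint and ordered. Where they agree, the common letter is \<open>0\<close> or \<open>1\<close>,
  because one of the words avoids \<open>a\<close>; there \<open>g\<close> is decreasing. At a nonpositive minimum of \<open>e\<close>
  the Laplacian of \<open>e\<close> and the difference of the reaction terms are then both nonnegative and sum to zero,
  so both vanish, and \<open>e\<close> is zero at this site and at its two neighbours. The zero spreads along the whole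
  lattice, which contradicts positivity at a site where the words differ. At an \<open>a\<close> shared by both words
  this argument would break down: there \<open>g\<close> increases and the coupling reverses the order.
\<close>

definition laplacian :: "(int \<Rightarrow> real) \<Rightarrow> int \<Rightarrow> real" where
  "laplacian u i = u (i - 1) - 2 * u i + u (i + 1)"

definition lattice_zero :: "real \<Rightarrow> real \<Rightarrow> (int \<Rightarrow> real) \<Rightarrow> bool" where
  "lattice_zero a t u \<longleftrightarrow> (\<forall>i. t * laplacian u i + g (u i) a = 0)"

text \<open>
  The derivatives of \<open>g\<close> at \<open>0\<close>, \<open>a\<close>, \<open>1\<close> are \<open>-a\<close>, \<open>a (1 - a)\<close>, \<open>-(1 - a)\<close>, each at least
  \<open>2 * slope a\<close> in modulus; half of this remains as a bound on the secant slopes nearby.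
\<close>

definition slope :: "real \<Rightarrow> real" where
  "slope a = a * (1 - a) / 2"

text \<open>
  By the estimate in \<open>secant_slope\<close>, the secant slopes of \<open>g\<close> within distance \<open>r \<le> 1\<close> of a zero differ
  from the derivative there by at most \<open>7 * r\<close>; with this radius the difference is at most
  \<open>slope a\<close>.
\<close>

definition radius :: "real \<Rightarrow> real" where
  "radius a = slope a / 7"

definition near :: "real \<Rightarrow> letter \<Rightarrow> real \<Rightarrow> bool" where
  "near a l x \<longleftrightarrow> \<bar>x - letter_val a l\<bar> \<le> radius a"

section \<open>Monotonicity of the cubic near its zeros\<close>

lemma slope_pos: "0 < a \<Longrightarrow> a < 1 \<Longrightarrow> 0 < slope a"
  by (simp add: slope_def)

lemma slope_le: "0 < a \<Longrightarrow> a < 1 \<Longrightarrow> 2 * slope a \<le> a \<and> 2 * slope a \<le> 1 - a"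
  by (simp add: slope_def mult_left_le mult_left_le_one_le)

lemma radius_bounds:
  assumes "0 < a" "a < 1"
  shows "0 < radius a" "radius a \<le> 1" "7 * radius a = slope a"
  using slope_pos[OF assms] slope_le[OF assms] assms by (auto simp: radius_def)

lemma g_letter: "g (letter_val a l) a = 0"
  by (cases l) (auto simp: g_def)

lemma letter_val_unit: "0 < a \<Longrightarrow> a < 1 \<Longrightarrow> 0 \<le> letter_val a l \<and> letter_val a l \<le> 1"
  by (cases l) auto

lemma near_letter: "0 < a \<Longrightarrow> a < 1 \<Longrightarrow> near a l (letter_val a l)"
  by (simp add: near_def radius_bounds(1) less_imp_le)

lemma near_abs: "0 < a \<Longrightarrow> a < 1 \<Longrightarrow> near a l x \<Longrightarrow> \<bar>x\<bar> \<le> 2"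
  using letter_val_unit[of a l] radius_bounds[of a] by (auto simp: near_def)

text \<open>
  Distinct zeros of \<open>g\<close> are at least \<open>slope a = 7 * radius a\<close> apart, more than two radii.
\<close>

lemma near_less:
  assumes "0 < a" "a < 1" "l < m" "near a l x" "near a m y"
  shows "x < y"
proof -
  have "letter_val a l + slope a \<le> letter_val a m"
    using assms(3) slope_le[OF assms(1,2)] slope_pos[OF assms(1,2)]
    by (cases l; cases m) (auto simp: less_letter_def)
  then show ?thesis
    using assms radius_bounds[OF assms(1,2)] by (auto simp: near_def)
qed

lemma g_secant:
  "g x a - g y a = (x - y) * ((1 + a) * (x + y) - (x\<^sup>2 + x * y + y\<^sup>2) - a)"
  by (simp add: g_def power2_eq_square algebra_simps)

text \<open>
  The secant slope from \<open>g_secant\<close> is a quadratic polynomial in \<open>x\<close> and \<open>y\<close> whose value at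
  \<open>x = y = z\<close> is the derivative of \<open>g\<close> at \<open>z\<close>; expanding it around a zero \<open>z\<close>
  leaves a remainder of at most \<open>4 r + 3 r\<^sup>2 \<le> 7 r = slope a\<close>, where \<open>r = radius a\<close>.
\<close>

lemma secant_slope:
  assumes a: "0 < a" "a < 1" and n: "near a l x" "near a l y"
  defines "q \<equiv> (1 + a) * (x + y) - (x\<^sup>2 + x * y + y\<^sup>2) - a"
  shows "l \<noteq> La \<Longrightarrow> q \<le> - slope a" "l = La \<Longrightarrow> slope a \<le> q"
proof -
  \<comment> \<open>Displacements from the zero; the secant slope is the derivative at \<open>z\<close> plus terms in \<open>p\<close> and \<open>s\<close>.\<close>
  define z p s r where "z = letter_val a l" and "p = x - z" and "s = y - z" and "r = radius a"
  have r: "0 < r" "r \<le> 1" "7 * r = slope a"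
    using radius_bounds[OF a] by (auto simp: r_def)
  have ps: "\<bar>p\<bar> \<le> r" "\<bar>s\<bar> \<le> r"
    using n by (auto simp: near_def p_def s_def z_def r_def)
  have q: "q = (2 * (1 + a) * z - 3 * z\<^sup>2 - a) +
      ((1 + a - 3 * z) * (p + s) - (p * p + p * s + s * s))"
    by (simp add: q_def p_def s_def power2_eq_square algebra_simps)
  have "\<bar>1 + a - 3 * z\<bar> \<le> 2"
    using a unfolding z_def by (cases l) auto
  then have "\<bar>(1 + a - 3 * z) * (p + s)\<bar> \<le> 2 * (2 * r)"
    unfolding abs_mult using ps by (intro mult_mono) auto
  moreover have "\<bar>u * v\<bar> \<le> r" if "\<bar>u\<bar> \<le> r" "\<bar>v\<bar> \<le> r" for u v
  proof -
    have "\<bar>u * v\<bar> \<le> r * 1"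
      unfolding abs_mult using that r by (intro mult_mono) auto
    then show ?thesis by simp
  qed
  from this[of p p] this[of p s] this[of s s] ps
  have "\<bar>p * p\<bar> \<le> r" "\<bar>p * s\<bar> \<le> r" "\<bar>s * s\<bar> \<le> r"
    by auto
  ultimately have dev: "\<bar>(1 + a - 3 * z) * (p + s) - (p * p + p * s + s * s)\<bar> \<le> slope a"
    using r(3) by linarith
  show "q \<le> - slope a" if "l \<noteq> La"
  proof -
    have "2 * (1 + a) * z - 3 * z\<^sup>2 - a \<le> - 2 * slope a"
      using that slope_le[OF a] by (cases l) (auto simp: z_def)
    then show ?thesis using dev q by linarith
  qed
  show "slope a \<le> q" if "l = La"
  proof -
    have "2 * (1 + a) * z - 3 * z\<^sup>2 - a = 2 * slope a"
      using that by (simp add: z_def slope_def power2_eq_square algebra_simps)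
    then show ?thesis using dev q by linarith
  qed
qed

lemma g_expanding:
  assumes a: "0 < a" "a < 1" and n: "near a l x" "near a l y"
  shows "slope a * \<bar>x - y\<bar> \<le> \<bar>g x a - g y a\<bar>"
proof -
  have "slope a \<le> \<bar>(1 + a) * (x + y) - (x\<^sup>2 + x * y + y\<^sup>2) - a\<bar>"
    using secant_slope[OF a n] by (cases "l = La") auto
  then show ?thesis
    unfolding g_secant abs_mult by (subst mult.commute) (intro mult_left_mono, auto)
qed

lemma g_decreasing:
  assumes a: "0 < a" "a < 1" and n: "near a l x" "near a l y" and "l \<noteq> La" "x \<le> y"
  shows "slope a * (y - x) \<le> g x a - g y a"
proof -
  have "(y - x) * slope a \<le> (y - x) * - ((1 + a) * (x + y) - (x\<^sup>2 + x * y + y\<^sup>2) - a)"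
    using secant_slope(1)[OF a n \<open>l \<noteq> La\<close>] \<open>x \<le> y\<close> by (intro mult_left_mono) auto
  also have "\<dots> = g x a - g y a"
    unfolding g_secant by (simp add: algebra_simps)
  finally show ?thesis by (simp add: mult.commute)
qed

text \<open>
  By the secant bounds \<open>g\<close> runs at least from \<open>- slope a * radius a\<close> to \<open>slope a * radius a\<close>, in one of the two
  directions, across the neighbourhood of a zero, so the intermediate value theorem applies.
\<close>

lemma g_local_inverse:
  assumes a: "0 < a" "a < 1" and s: "\<bar>s\<bar> \<le> slope a * radius a"
  shows "\<exists>x. near a l x \<and> g x a = s"
proof -
  define z r where "z = letter_val a l" and "r = radius a"
  have r: "0 < r" using radius_bounds[OF a] by (simp add: r_def)
  have n: "near a l (z - r)" "near a l (z + r)" "near a l z"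
    using r by (auto simp: near_def z_def r_def)
  have z0: "g z a = 0" by (simp add: z_def g_letter)
  have cont: "continuous_on {z - r..z + r} (\<lambda>x. g x a)"
    unfolding g_def by (intro continuous_intros)
  have "\<exists>x\<ge>z - r. x \<le> z + r \<and> g x a = s"
  proof (cases "l = La")
    case True
    have q: "(- r) * ((1 + a) * (z - r + z) - ((z - r)\<^sup>2 + (z - r) * z + z\<^sup>2) - a) \<le> (- r) * slope a"
      "r * slope a \<le> r * ((1 + a) * (z + r + z) - ((z + r)\<^sup>2 + (z + r) * z + z\<^sup>2) - a)"
      using secant_slope(2)[OF a n(1,3) True] secant_slope(2)[OF a n(2,3) True] r
      by (auto intro: mult_left_mono mult_left_mono_neg)
    have "g (z - r) a \<le> s" "s \<le> g (z + r) a"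
      using q s g_secant[of "z - r" a z] g_secant[of "z + r" a z] z0
      by (auto simp: r_def mult.commute)
    then show ?thesis using IVT'[OF _ _ _ cont] r by auto
  next
    case False
    have "g (z + r) a \<le> s" "s \<le> g (z - r) a"
      using g_decreasing[OF a n(1,3) False] g_decreasing[OF a n(3,2) False] r s z0
      by (auto simp: r_def)
    then show ?thesis using IVT2'[OF _ _ _ cont] r by auto
  qed
  then obtain x where "z - r \<le> x" "x \<le> z + r" "g x a = s" by blast
  then have "near a l x" by (simp add: near_def z_def r_def abs_le_iff)
  then show ?thesis using \<open>g x a = s\<close> by blast
qed

section \<open>Stationary solutions close to a word\<close>

lemma laplacian_bound:
  assumes "\<And>i. \<bar>u i\<bar> \<le> B"
  shows "\<bar>laplacian u i\<bar> \<le> 4 * B"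
  using assms[of "i - 1"] assms[of i] assms[of "i + 1"] by (auto simp: laplacian_def)

lemma laplacian_diff: "laplacian u i - laplacian v i = laplacian (\<lambda>j. u j - v j) i"
  by (simp add: laplacian_def)

lemma laplacian_near:
  assumes "0 < a" "a < 1" "\<And>i. near a (W i) (u i)"
  shows "\<bar>laplacian u i\<bar> \<le> 8"
  using laplacian_bound[of u 2] near_abs[OF assms(1,2)] assms(3) by fastforce

lemma small_coupling:
  assumes "0 < a" "a < 1" "8 * t \<le> slope a * radius a"
  shows "8 * t \<le> slope a"
proof -
  have "slope a * radius a \<le> slope a * 1"
    using slope_pos[OF assms(1,2)] radius_bounds[OF assms(1,2)] by (intro mult_left_mono) auto
  then show ?thesis using assms by simp
qed

text \<open>
  At each site \<open>slope a * \<bar>u i - v i\<bar>\<close> is bounded by the difference of the coupling terms, at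
  most \<open>8 * \<bar>t - s\<bar> + 4 * t * M\<close> with \<open>M\<close> the supremum of all differences. As \<open>4 * t \<le> slope a / 2\<close>,
  half of \<open>M\<close> can be absorbed on the left. The case \<open>s = t\<close> is uniqueness.
\<close>

lemma zero_lipschitz:
  assumes a: "0 < a" "a < 1" and t: "0 \<le> t" "8 * t \<le> slope a * radius a"
    and u: "lattice_zero a t u" "\<And>i. near a (W i) (u i)"
    and v: "lattice_zero a s v" "\<And>i. near a (W i) (v i)"
  shows "\<bar>u i - v i\<bar> \<le> 16 * \<bar>t - s\<bar> / slope a"
proof -
  define M where "M = (SUP i. \<bar>u i - v i\<bar>)"
  have bdd: "bdd_above (range (\<lambda>i. \<bar>u i - v i\<bar>))"
  proof (rule bdd_aboveI2)
    fix i show "\<bar>u i - v i\<bar> \<le> 4"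
      using near_abs[OF a u(2), of i] near_abs[OF a v(2), of i] by linarith
  qed
  have le: "\<bar>u i - v i\<bar> \<le> M" for i
    unfolding M_def using bdd by (rule cSUP_upper[OF UNIV_I])
  then have M0: "0 \<le> M" by (meson abs_ge_zero order_trans)
  have sl: "0 < slope a" "8 * t \<le> slope a"
    using slope_pos[OF a] small_coupling[OF a t(2)] by auto
  have "\<bar>u i - v i\<bar> \<le> 8 * \<bar>t - s\<bar> / slope a + M / 2" for i
  proof -
    have "g (u i) a - g (v i) a = - t * laplacian (\<lambda>j. u j - v j) i - (t - s) * laplacian v i"
      using u(1) v(1) unfolding lattice_zero_def laplacian_diff[symmetric]
      by (smt (verit) left_diff_distrib right_diff_distrib mult_minus_left)
    moreover have "\<bar>t * laplacian (\<lambda>j. u j - v j) i\<bar> \<le> t * (4 * M)"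
      unfolding abs_mult using t laplacian_bound[of "\<lambda>j. u j - v j" M i, OF le]
      by (intro mult_mono) auto
    moreover have "\<bar>(t - s) * laplacian v i\<bar> \<le> \<bar>t - s\<bar> * 8"
      unfolding abs_mult using laplacian_near[OF a v(2)] by (intro mult_left_mono) auto
    moreover have "t * (4 * M) \<le> slope a * (M / 2)"
      using mult_right_mono[OF sl(2) M0] by linarith
    ultimately have "slope a * \<bar>u i - v i\<bar> \<le> slope a * (M / 2) + \<bar>t - s\<bar> * 8"
      using g_expanding[OF a u(2) v(2), of i] by linarith
    then show ?thesis using sl(1) by (simp add: field_simps)
  qed
  then have "M \<le> 8 * \<bar>t - s\<bar> / slope a + M / 2"
    unfolding M_def by (intro cSUP_least) auto
  then show ?thesis using le[of i] by simp
qed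

lemma zero_unique:
  assumes "0 < a" "a < 1" "0 \<le> t" "8 * t \<le> slope a * radius a"
    and "lattice_zero a t u" "\<And>i. near a (W i) (u i)"
    and "lattice_zero a t v" "\<And>i. near a (W i) (v i)"
  shows "u = v"
proof
  fix i show "u i = v i" using zero_lipschitz[OF assms, of i] by simp
qed

lemma convergent_geometric_steps:
  fixes x :: "nat \<Rightarrow> real"
  assumes "\<And>k. \<bar>x (Suc k) - x k\<bar> \<le> C * (1 / 2) ^ k"
  shows "convergent x"
proof -
  have "summable (\<lambda>k. x (Suc k) - x k)"
    by (rule summable_comparison_test'[where g = "\<lambda>k. C * (1 / 2) ^ k"])
      (use assms in \<open>auto intro!: summable_mult summable_geometric\<close>)
  then have "convergent (\<lambda>k. x k - x 0)"
    by (simp add: summable_iff_convergent sum_lessThan_telescope)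
  then show ?thesis
    using convergent_add[OF _ convergent_const[of "x 0"]] by fastforce
qed

text \<open>
  Fixed point iteration: the next iterate is the local inverse of \<open>g\<close> at each site, applied to minus the
  coupling term of the current one. This map is a contraction with factor \<open>1 / 2\<close> in the supremum norm. The
  condition on \<open>t\<close> makes the coupling term small enough for the local inverse to be defined. The iterates
  converge at every site, and the equations pass to the limit.
\<close>

lemma zero_exists:
  assumes a: "0 < a" "a < 1" and t: "0 \<le> t" "8 * t \<le> slope a * radius a"
  shows "\<exists>u. lattice_zero a t u \<and> (\<forall>i. near a (W i) (u i))"
proof -
  have sl: "0 < slope a" "8 * t \<le> slope a"
    using slope_pos[OF a] small_coupling[OF a t(2)] by auto
  have step: "\<exists>u'. (\<forall>i. near a (W i) (u' i)) \<and> (\<forall>i. g (u' i) a = - t * laplacian u i)"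
    if u: "\<forall>i. near a (W i) (u i)" for u
  proof -
    have "\<bar>- t * laplacian u i\<bar> \<le> slope a * radius a" for i
    proof -
      have "t * \<bar>laplacian u i\<bar> \<le> t * 8"
        using laplacian_near[OF a, of W u] u t by (intro mult_left_mono) auto
      then show ?thesis using t by (simp add: abs_mult)
    qed
    then have "\<forall>i. \<exists>x. near a (W i) x \<and> g x a = - t * laplacian u i"
      using g_local_inverse[OF a] by blast
    from choice[OF this] show ?thesis by blast
  qed
  have "\<exists>f. \<forall>k. (\<forall>i. near a (W i) (f k i)) \<and> (\<forall>i. g (f (Suc k) i) a = - t * laplacian (f k) i)"
  proof (rule dependent_nat_choice)
    show "\<exists>u. \<forall>i. near a (W i) (u i)"
      using near_letter[OF a] by (intro exI[of _ "\<lambda>i. letter_val a (W i)"]) blast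
  qed (rule step)
  then obtain X where Xn: "\<And>k i. near a (W i) (X k i)"
    and XS: "\<And>k i. g (X (Suc k) i) a = - t * laplacian (X k) i"
    by blast
  have geo: "\<bar>X (Suc k) i - X k i\<bar> \<le> 4 * (1 / 2) ^ k" for k i
  proof (induction k arbitrary: i)
    case 0
    show ?case using near_abs[OF a Xn, of "Suc 0" i] near_abs[OF a Xn, of 0 i] by simp
  next
    case (Suc k)
    have "slope a * \<bar>X (Suc (Suc k)) i - X (Suc k) i\<bar>
        \<le> \<bar>g (X (Suc (Suc k)) i) a - g (X (Suc k) i) a\<bar>"
      by (rule g_expanding[OF a Xn Xn])
    also have "\<dots> = t * \<bar>laplacian (\<lambda>j. X (Suc k) j - X k j) i\<bar>"
    proof -
      have "g (X (Suc (Suc k)) i) a - g (X (Suc k) i) a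
          = - (t * laplacian (\<lambda>j. X (Suc k) j - X k j) i)"
        unfolding XS laplacian_diff[symmetric] by (simp add: algebra_simps)
      then show ?thesis using t(1) by (simp add: abs_mult)
    qed
    also have "\<dots> \<le> t * (4 * (4 * (1 / 2) ^ k))"
      using laplacian_bound[of "\<lambda>j. X (Suc k) j - X k j", OF Suc.IH] t(1)
      by (intro mult_left_mono) auto
    also have "\<dots> = (8 * t) * (4 * (1 / 2) ^ Suc k)" by simp
    also have "\<dots> \<le> slope a * (4 * (1 / 2) ^ Suc k)"
      by (intro mult_right_mono sl) auto
    finally show ?case using sl(1) by simp
  qed
  define u where "u i = lim (\<lambda>k. X k i)" for i
  have lim: "(\<lambda>k. X k i) \<longlonglongrightarrow> u i" for i
    unfolding u_def convergent_LIMSEQ_iff[symmetric] using geo by (rule convergent_geometric_steps)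
  have "lattice_zero a t u"
    unfolding lattice_zero_def
  proof
    fix i
    have "(\<lambda>k. t * laplacian (X k) i + g (X (Suc k) i) a)
        \<longlonglongrightarrow> t * laplacian u i + g (u i) a"
      unfolding laplacian_def g_def by (intro tendsto_intros lim LIMSEQ_Suc)
    moreover have "(\<lambda>k. t * laplacian (X k) i + g (X (Suc k) i) a) = (\<lambda>k. 0)"
      by (simp add: XS)
    ultimately show "t * laplacian u i + g (u i) a = 0"
      by (metis LIMSEQ_unique tendsto_const)
  qed
  moreover have "near a (W i) (u i)" for i
  proof -
    have "(\<lambda>k. \<bar>X k i - letter_val a (W i)\<bar>) \<longlonglongrightarrow> \<bar>u i - letter_val a (W i)\<bar>"
      by (intro tendsto_intros lim)
    then show ?thesis
      unfolding near_def by (rule LIMSEQ_le_const2) (use Xn in \<open>auto simp: near_def\<close>)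
  qed
  ultimately show ?thesis by blast
qed

text \<open>
  The neighbourhood of a word traps its solutions: they stay off the boundary. This makes the set of
  parameters at which a branch is close to its word open as well as closed.
\<close>

lemma zero_strictly_near:
  assumes a: "0 < a" "a < 1" and t: "0 \<le> t" "8 * t < slope a * radius a"
    and u: "lattice_zero a t u" "\<And>i. near a (W i) (u i)"
  shows "\<bar>u i - letter_val a (W i)\<bar> < radius a"
proof -
  have "slope a * \<bar>u i - letter_val a (W i)\<bar> \<le> \<bar>g (u i) a\<bar>"
    using g_expanding[OF a u(2) near_letter[OF a]] by (simp add: g_letter)
  also have "\<dots> = t * \<bar>laplacian u i\<bar>"
  proof -
    have "g (u i) a = - (t * laplacian u i)"
      using u(1) unfolding lattice_zero_def by (metis add.commute eq_neg_iff_add_eq_0)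
    then show ?thesis using t(1) by (simp add: abs_mult)
  qed
  also have "\<dots> \<le> t * 8"
    using laplacian_near[OF a u(2)] t(1) by (intro mult_left_mono) auto
  also have "\<dots> < slope a * radius a" using t(2) by simp
  finally show ?thesis using slope_pos[OF a] by simp
qed

section \<open>Maximum principles for periodic solutions\<close>

lemma wrap_id: "i \<in> {1..int n} \<Longrightarrow> wrap n i = i"
  by (simp add: wrap_def)

lemma wrap_shift: "wrap n (i + int n * k) = wrap n i"
  unfolding wrap_def using mod_mult_self2[of "i - 1" "int n" k] by (simp add: add_diff_eq diff_add_eq)

lemma periodic_attains_min:
  fixes f :: "int \<Rightarrow> real"
  assumes "n > 0" "\<And>i. f (wrap n i) = f i"
  obtains j where "\<And>i. f j \<le> f i"
proof -
  have "finite {1..int n}" "{1..int n} \<noteq> {}" using assms(1) by auto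
  then obtain j where "\<forall>i\<in>{1..int n}. f j \<le> f i"
    using ex_is_arg_min_if_finite[of "{1..int n}" f] unfolding is_arg_min_linorder by blast
  then have "f j \<le> f i" for i
    using wrap_in[OF assms(1), of i] assms(2)[of i] by metis
  then show ?thesis by (rule that)
qed

text \<open>
  At a negative minimum the Laplacian would be nonnegative and \<open>g\<close> positive, so their sum could not vanish.
\<close>

lemma zero_nonneg:
  assumes "0 < a" "n > 0" "0 \<le> t" "lattice_zero a t u" "\<And>i. u (wrap n i) = u i"
  shows "0 \<le> u i"
proof -
  obtain j where j: "\<And>i. u j \<le> u i"
    using periodic_attains_min[of n u, OF assms(2,5)] by blast
  have "0 \<le> t * laplacian u j"
    using assms(3) j[of "j - 1"] j[of "j + 1"] by (simp add: laplacian_def)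
  then have "g (u j) a \<le> 0"
    using assms(4) unfolding lattice_zero_def by (smt (verit))
  moreover have "g (u j) a > 0" if "u j < 0"
    using that assms(1) unfolding g_def by (intro mult_neg_neg mult_neg_pos) auto
  ultimately show ?thesis using j[of i] by linarith
qed

text \<open>
  The symmetry \<open>u \<mapsto> 1 - u\<close> exchanges the two stable states and \<open>a\<close> with \<open>1 - a\<close>; it turns
  the lower bound \<open>0\<close> into the upper bound \<open>1\<close>.
\<close>

lemma zero_reflect:
  assumes "lattice_zero a t u"
  shows "lattice_zero (1 - a) t (\<lambda>i. 1 - u i)"
  unfolding lattice_zero_def
proof
  fix i
  have "t * laplacian (\<lambda>i. 1 - u i) i + g (1 - u i) (1 - a) = - (t * laplacian u i + g (u i) a)"
    by (simp add: laplacian_def g_def algebra_simps)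
  then show "t * laplacian (\<lambda>i. 1 - u i) i + g (1 - u i) (1 - a) = 0"
    using assms unfolding lattice_zero_def by simp
qed

lemma zero_in_unit_interval:
  assumes "0 < a" "a < 1" "n > 0" "0 \<le> t" "lattice_zero a t u" "\<And>i. u (wrap n i) = u i"
  shows "u i \<in> {0..1}"
proof -
  have "0 \<le> u i"
    by (rule zero_nonneg[of a n t u, OF assms(1,3-6)])
  moreover have "0 \<le> 1 - u i"
    by (rule zero_nonneg[of "1 - a" n t "\<lambda>i. 1 - u i"]) (use assms zero_reflect in auto)
  ultimately show ?thesis by simp
qed

text \<open>
  The strong maximum principle for \<open>v - u\<close>. The assumption that equal letters are not \<open>a\<close> is
  the form in which it enters that one of the words is in \<open>{0, 1}\<^sup>n\<close>.
\<close>

lemma zero_comparison: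
  assumes a: "0 < a" "a < 1" and "n > 0" and t: "0 < t"
    and u: "lattice_zero a t u" "\<And>i. near a (V i) (u i)" "\<And>i. u (wrap n i) = u i"
    and v: "lattice_zero a t v" "\<And>i. near a (W i) (v i)" "\<And>i. v (wrap n i) = v i"
    and le: "\<And>i. V i \<le> W i" and stable: "\<And>i. V i = W i \<Longrightarrow> V i \<noteq> La"
    and less: "V k < W k"
  shows "u i < v i"
proof -
  define e where "e i = v i - u i" for i
  have pos: "0 < e i" if "V i \<noteq> W i" for i
    using near_less[OF a _ u(2) v(2), of i i] le[of i] that by (auto simp: e_def)
  \<comment> \<open>A nonpositive minimum is zero, and is shared by both neighbours.\<close>
  have touch: "e j = 0 \<and> e (j - 1) = 0 \<and> e (j + 1) = 0"
    if min: "\<And>i. e j \<le> e i" and "e j \<le> 0" for j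
  proof -
    have eq: "V j = W j" using pos[of j] that by force
    have "slope a * (u j - v j) \<le> g (v j) a - g (u j) a"
      using g_decreasing[OF a v(2)[of j] _ _, of "u j"] u(2)[of j] eq stable[OF eq] \<open>e j \<le> 0\<close>
      by (simp add: e_def)
    moreover have "0 \<le> slope a * (u j - v j)"
      using slope_pos[OF a] \<open>e j \<le> 0\<close> by (simp add: e_def)
    moreover have "t * laplacian e j + (g (v j) a - g (u j) a) = 0"
    proof -
      have "laplacian e j = laplacian v j - laplacian u j"
        by (simp add: e_def laplacian_def)
      then show ?thesis
        using u(1) v(1) unfolding lattice_zero_def by (smt (verit) right_diff_distrib)
    qed
    moreover have "0 \<le> laplacian e j"
      using min[of "j - 1"] min[of "j + 1"] by (simp add: laplacian_def)
    moreover from this have "0 \<le> t * laplacian e j" using t by simp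
    ultimately have "slope a * (u j - v j) = 0" "t * laplacian e j = 0" by linarith+
    then have "e j = 0" "laplacian e j = 0" using slope_pos[OF a] t by (auto simp: e_def)
    then show ?thesis
      using min[of "j - 1"] min[of "j + 1"] by (auto simp: laplacian_def)
  qed
  have "e (wrap n i) = e i" for i by (simp add: e_def u v)
  then obtain j where j: "\<And>i. e j \<le> e i"
    using periodic_attains_min[of n e, OF \<open>n > 0\<close>] by blast
  have "0 < e j"
  proof (rule ccontr)
    assume "\<not> 0 < e j"
    then have ej: "e j = 0" using touch[OF j] by simp
    have "e k = 0"
    proof (induction k rule: int_induct[where k = j])
      case base
      show ?case by (rule ej)
    next
      case (step1 i)
      then show ?case using touch[of i] j ej by simp
    next
      case (step2 i)
      then show ?case using touch[of i] j ej by simp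
    qed
    then show False using pos[of k] less by (metis less_irrefl)
  qed
  then show ?thesis using j[of i] by (simp add: e_def)
qed

section \<open>Branches of periodic solutions\<close>

lemma zero_of_G_iff_lattice_zero:
  assumes "n > 0" "u \<in> vectors n"
  shows "zero_of_G n a t u \<longleftrightarrow> lattice_zero a t (periodic_extension n u)"
  unfolding periodic_extension_stationary[OF assms] nagumo_lattice_solution_def
    lattice_zero_def laplacian_def
  by (metis DERIV_const DERIV_unique)

text \<open>
  A translate by a multiple of \<open>n\<close> solves the same equation close to the same periodic word, so uniqueness
  makes the solution periodic. The construction on the infinite lattice thus also yields the solutions of the
  \<open>n\<close>-dimensional problem.
\<close>

lemma zero_periodic:
  assumes a: "0 < a" "a < 1" and t: "0 \<le> t" "8 * t \<le> slope a * radius a"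
    and u: "lattice_zero a t u" "\<And>i. near a (w (wrap n i)) (u i)"
  shows "u (wrap n i) = u i"
proof -
  have shift: "u (j + int n * k) = u j" for j k
  proof -
    have "lattice_zero a t (\<lambda>j. u (j + int n * k))"
      unfolding lattice_zero_def laplacian_def
    proof
      fix j
      show "t * (u (j - 1 + int n * k) - 2 * u (j + int n * k) + u (j + 1 + int n * k))
          + g (u (j + int n * k)) a = 0"
        using u(1)[unfolded lattice_zero_def laplacian_def, rule_format, of "j + int n * k"]
        by (simp add: algebra_simps)
    qed
    moreover have "near a (w (wrap n j)) (u (j + int n * k))" for j
      using u(2)[of "j + int n * k"] by (simp add: wrap_shift)
    ultimately show ?thesis
      using zero_unique[OF a t, of "\<lambda>j. u (j + int n * k)" "\<lambda>i. w (wrap n i)" u] u by metis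
  qed
  have "wrap n i = i + int n * (- ((i - 1) div int n))"
    by (simp add: wrap_def minus_mult_div_eq_mod[symmetric])
  then show ?thesis using shift by metis
qed

text \<open>
  The parameters at which all components are within the radius form a closed set by continuity and an open one,
  because then they are strictly within it; as it contains \<open>0\<close>, it is all of the interval.
\<close>

lemma branch_stays_near:
  assumes a: "0 < a" "a < 1" and n: "n > 0"
    and d: "8 * d < slope a * radius a"
    and v: "branch n a w d v" and t: "t \<in> {0..d}"
  shows "near a (w (wrap n i)) (periodic_extension n (v t) i)"
proof -
  define dev where "dev i t = \<bar>v t i - letter_val a (w i)\<bar>" for i t
  define S where "S = {t \<in> {0..d}. \<forall>i\<in>{1..int n}. dev i t \<le> radius a}"
  have cont: "continuous_on {0..d} (dev i)" if "i \<in> {1..int n}" for i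
    using v that unfolding branch_def dev_def by (intro continuous_intros) auto
  have S_near: "near a (w (wrap n i)) (periodic_extension n (v t) i)" if "t \<in> S" for t i
    using that wrap_in[OF n, of i] by (simp add: S_def dev_def near_def periodic_extension_def)
  have strict: "dev i t < radius a" if "t \<in> S" "i \<in> {1..int n}" for t i
  proof -
    have t: "0 \<le> t" "8 * t < slope a * radius a" and "zero_of_G n a t (v t)"
      using that d v by (auto simp: S_def branch_def)
    then have "lattice_zero a t (periodic_extension n (v t))"
      using zero_of_G_iff_lattice_zero[OF n] by (auto simp: zero_of_G_def)
    from zero_strictly_near[OF a t this, of "\<lambda>i. w (wrap n i)", OF S_near[OF that(1)], of i]
    show ?thesis using that(2) by (simp add: dev_def periodic_extension_def wrap_id)
  qed
  have ne: "{1..int n} \<noteq> {}" "finite {1..int n}" using n by auto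
  have "closedin (top_of_set {0..d}) S"
  proof -
    have "S = (\<Inter>i\<in>{1..int n}. {0..d} \<inter> dev i -` {..radius a})"
      using ne(1) by (auto simp: S_def)
    then show ?thesis
      using ne cont by (simp only:) (intro closedin_INT continuous_closedin_preimage, auto)
  qed
  moreover have "openin (top_of_set {0..d}) S"
  proof -
    have "S = (\<Inter>i\<in>{1..int n}. {0..d} \<inter> dev i -` {..<radius a})"
      using ne strict by (fastforce simp: S_def)
    then show ?thesis
      using ne cont by (simp only:) (intro openin_INT2 continuous_openin_preimage_gen, auto)
  qed
  moreover have "0 \<in> S"
    using t v radius_bounds(1)[OF a] by (auto simp: S_def dev_def branch_def word_vec_def)
  ultimately have "S = {0..d}"
    using connected_clopen[of "{0..d}"] connected_Icc by blast
  then show ?thesis using S_near t by blast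
qed

lemma vector_eq_restrict_extension:
  assumes "u \<in> vectors n"
  shows "u = restrict (periodic_extension n u) {1..int n}"
proof
  fix i show "u i = restrict (periodic_extension n u) {1..int n} i"
  proof (cases "i \<in> {1..int n}")
    case True
    then show ?thesis by (simp only: periodic_extension_def wrap_id restrict_apply if_True)
  next
    case False
    then show ?thesis
      using PiE_arb[OF assms[unfolded vectors_def] False] by (simp only: restrict_apply if_False)
  qed
qed

lemma periodic_extension_restrict:
  assumes "n > 0" "\<And>i. u (wrap n i) = u i"
  shows "periodic_extension n (restrict u {1..int n}) = u"
  unfolding periodic_extension_def using wrap_in[OF assms(1)] assms(2)
  by (simp only: restrict_apply if_True)

lemma continuation_is_branch:
  assumes a: "0 < a" "a < 1" and n: "n > 0" and d: "8 * d \<le> slope a * radius a"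
    and U: "\<And>t. t \<in> {0..d} \<Longrightarrow> lattice_zero a t (U t)"
      "\<And>t i. t \<in> {0..d} \<Longrightarrow> near a (w (wrap n i)) (U t i)"
    and "0 \<le> d"
  shows "branch n a w d (\<lambda>t. restrict (U t) {1..int n})"
proof -
  have per: "U t (wrap n i) = U t i" if "t \<in> {0..d}" for t i
    using that d by (intro zero_periodic[OF a _ _ U(1) U(2)]) auto
  have "U 0 = (\<lambda>i. letter_val a (w (wrap n i)))"
  proof (rule zero_unique[OF a, of 0])
    show "lattice_zero a 0 (\<lambda>i. letter_val a (w (wrap n i)))"
      by (simp add: lattice_zero_def g_letter)
  qed (use U[of 0] near_letter[OF a] slope_pos[OF a] radius_bounds(1)[OF a] \<open>0 \<le> d\<close> in auto)
  then have "restrict (U 0) {1..int n} = word_vec n a w"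
    by (auto simp: word_vec_def wrap_id)
  moreover have "zero_of_G n a t (restrict (U t) {1..int n})" if "t \<in> {0..d}" for t
    using zero_of_G_iff_lattice_zero[OF n, of "restrict (U t) {1..int n}"] U(1)[OF that]
      periodic_extension_restrict[OF n, of "U t"] per[OF that]
    by (simp add: vectors_def)
  moreover have "continuous_on {0..d} (\<lambda>t. U t i)" for i
  proof (rule lipschitz_on_continuous_on)
    show "(16 / slope a)-lipschitz_on {0..d} (\<lambda>t. U t i)"
    proof (rule lipschitz_onI)
      fix s t assume st: "s \<in> {0..d}" "t \<in> {0..d}"
      show "dist (U s i) (U t i) \<le> 16 / slope a * dist s t"
        using zero_lipschitz[OF a _ _ U(1)[OF st(1)] U(2)[OF st(1)] U(1)[OF st(2)] U(2)[OF st(2)],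
            of i] st d by (simp add: dist_real_def)
    qed (use slope_pos[OF a] in auto)
  qed
  ultimately show ?thesis
    by (simp add: branch_def)
qed

text \<open>
  The definite description behind \<open>type_solution\<close> is proper: the solutions close to \<open>w\<close> form a
  branch with values in \<open>[0, 1]\<close>, and every other branch stays close to \<open>w\<close> and therefore coincides with them.
\<close>

lemma periodic_type_solution_characterization:
  fixes w :: "int \<Rightarrow> letter"
  assumes a: "0 < a" "a < 1" and n: "n > 0" and d: "0 \<le> d" "8 * d < slope a * radius a"
  defines "u \<equiv> periodic_type_solution n a d w"
  shows "lattice_zero a d u" "near a (w (wrap n i)) (u i)" "u (wrap n i) = u i"
proof -
  have small: "0 \<le> t \<and> 8 * t \<le> slope a * radius a" if "t \<in> {0..d}" for t
    using that d by auto
  obtain U where U: "\<And>t. t \<in> {0..d} \<Longrightarrow> lattice_zero a t (U t)"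
      "\<And>t i. t \<in> {0..d} \<Longrightarrow> near a (w (wrap n i)) (U t i)"
  proof -
    have "\<forall>t\<in>{0..d}. \<exists>u. lattice_zero a t u \<and> (\<forall>i. near a (w (wrap n i)) (u i))"
      using zero_exists[OF a, of _ "\<lambda>i. w (wrap n i)"] small by blast
    from bchoice[OF this] show ?thesis using that by blast
  qed
  have dd: "d \<in> {0..d}" using d by simp
  have per: "U d (wrap n i) = U d i" for i
    using small[OF dd] by (intro zero_periodic[OF a _ _ U(1)[OF dd] U(2)[OF dd]]) auto
  have "type_solution n a d w = restrict (U d) {1..int n}"
    unfolding type_solution_def
  proof (rule the_equality)
    have "U d i \<in> {0..1}" for i
      by (rule zero_in_unit_interval[of a n d "U d", OF a n d(1) U(1)[OF dd] per])
    then show "restrict (U d) {1..int n} \<in> {1..int n} \<rightarrow>\<^sub>E {0..1} \<and>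
        (\<exists>v. branch n a w d v \<and> v d = restrict (U d) {1..int n})"
      using continuation_is_branch[OF a n _ U d(1)] d(2) by fastforce
  next
    fix x assume "x \<in> {1..int n} \<rightarrow>\<^sub>E {0..1} \<and> (\<exists>v. branch n a w d v \<and> v d = x)"
    then obtain v where v: "branch n a w d v" "v d = x" by blast
    then have x: "zero_of_G n a d x" "x \<in> vectors n"
      using dd by (auto simp: branch_def zero_of_G_def)
    have "periodic_extension n x = U d"
    proof (rule zero_unique[OF a])
      show "lattice_zero a d (periodic_extension n x)"
        using zero_of_G_iff_lattice_zero[OF n] x by blast
      show "near a (w (wrap n i)) (periodic_extension n x i)" for i
        using branch_stays_near[OF a n d(2) v(1) dd] v(2) by simp
    qed (use small[OF dd] U[OF dd] in auto)
    then show "x = restrict (U d) {1..int n}"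
      using vector_eq_restrict_extension[OF x(2)] by simp
  qed
  then have "u = U d"
    unfolding u_def periodic_type_solution_def using periodic_extension_restrict[OF n] per by metis
  then show "lattice_zero a d u" "near a (w (wrap n i)) (u i)" "u (wrap n i) = u i"
    using U[OF dd] per by auto
qed

section \<open>Strict ordering of the solutions\<close>

theorem lemma3:
  fixes n :: nat and a :: real
  assumes "n \<ge> 2" and "0 < a" and "a < 1"
  shows "\<exists>d0>0. \<forall>d. 0 < d \<and> d < d0 \<longrightarrow>
    (\<forall>wA\<in>words n. \<forall>wB\<in>words n.
       wA \<noteq> wB \<longrightarrow>
       (\<forall>i\<in>{1..int n}. wA i \<le> wB i) \<longrightarrow>
       wA \<in> binary_words n \<or> wB \<in> binary_words n \<longrightarrow>
       (\<forall>i::int. periodic_type_solution n a d wA i < periodic_type_solution n a d wB i))"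
proof (intro exI[of _ "slope a * radius a / 8"] conjI allI impI ballI)
  \<comment> \<open>On configurations close to a word the Laplacian is at most \<open>8\<close>, so for these \<open>d\<close> the coupling
    stays within the range that \<open>g\<close> covers near each of its zeros.\<close>
  show "0 < slope a * radius a / 8"
    using slope_pos[OF assms(2,3)] radius_bounds(1)[OF assms(2,3)] by simp
next
  fix d wA wB and i :: int
  assume d: "0 < d \<and> d < slope a * radius a / 8"
    and w: "wA \<in> words n" "wB \<in> words n" "wA \<noteq> wB" "\<forall>i\<in>{1..int n}. wA i \<le> wB i"
    and bin: "wA \<in> binary_words n \<or> wB \<in> binary_words n"
  have n: "n > 0" and small: "0 \<le> d" "8 * d < slope a * radius a"
    using assms d by auto
  note sol = periodic_type_solution_characterization[OF assms(2,3) n small]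
  obtain k where k: "k \<in> {1..int n}" "wA k \<noteq> wB k"
    using w(3) PiE_ext[of wA "{1..int n}" "\<lambda>_. UNIV" wB] w(1,2) unfolding words_def by blast
  show "periodic_type_solution n a d wA i < periodic_type_solution n a d wB i"
  proof (rule zero_comparison[OF assms(2,3) n _ sol sol])
    show "wA (wrap n j) \<le> wB (wrap n j)" for j
      using w(4) wrap_in[OF n] by blast
    show "wA (wrap n j) \<noteq> La" if "wA (wrap n j) = wB (wrap n j)" for j
      using bin that wrap_in[OF n, of j] unfolding binary_words_def by (auto dest!: PiE_mem)
    show "wA (wrap n k) < wB (wrap n k)"
      using k w(4) by (simp add: wrap_id less_le)
  qed (use d in auto)
qed

end
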